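(* In the 2D case and in the 3D case ($n=2$ and $n=3$), there exists a smooth solution on $\mathbb{T}^n$ of the inviscid, unforced rotational Burgers equation $$\partial_t\mathbf{u}+(\nabla\times\mathbf{u})\times\mathbf{u}=\mathbf{0}\quad(n=3),\qquad\text{respectively}\qquad \partial_t\mathbf{u}+\omega\,\mathbf{u}^\perp=\mathbf{0}\quad(n=2),$$ with initial condition $\mathbf{u}(0)=\mathbf{u}_0$, which becomes singular in finite time.
   Context: $\mathbb{T}^n=\mathbb{R}^n/(2\pi\mathbb{Z})^n$ (periodic boundary conditions) and $\mathbf{u}=\mathbf{u}(\mathbf{x},t)$ is $\mathbb{R}^n$-valued, not required to be divergence-free. In the case $n=2$, with $\mathbf{u}=(u_1,u_2)$ and coordinates $(x,y)$, $\omega:=\partial_xu_2-\partial_yu_1$ and $\mathbf{u}^\perp:=(-u_2,u_1)$; this is the two-dimensional form of the equation. *)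

theory Defs
  imports "HOL-Analysis.Analysis"
begin

text \<open>
  Functions on the torus \<open>\<real>\<^sup>n / (2 \<pi> \<int>)\<^sup>n\<close> are functions on \<open>\<real>\<^sup>n\<close> that are \<open>2 \<pi>\<close>-periodic in each
  coordinate; a time-dependent vector field \<open>u\<close> has the value \<open>u t x\<close> at time \<open>t\<close> and point \<open>x\<close>.
\<close>

definition torus_periodic :: "(real ^ 'n \<Rightarrow> 'b) \<Rightarrow> bool" where
  "torus_periodic f \<longleftrightarrow> (\<forall>i x. f (x + (2 * pi) *\<^sub>R axis i 1) = f x)"

text \<open>
  Derivatives are taken within \<open>S\<close>, hence are one-sided at the boundary. The notion is intended for
  convex \<open>S\<close> with nonempty interior, such as \<open>{0..<T} \<times> UNIV\<close>, where these derivatives are unique.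
\<close>

primrec Ck_on ::
    "nat \<Rightarrow> 'a::real_normed_vector set \<Rightarrow> ('a \<Rightarrow> 'b::real_normed_vector) \<Rightarrow> bool" where
  "Ck_on 0 S f \<longleftrightarrow> continuous_on S f"
| "Ck_on (Suc k) S f \<longleftrightarrow>
     f differentiable_on S \<and> (\<forall>v. Ck_on k S (\<lambda>p. frechet_derivative f (at p within S) v))"

definition smooth_on ::
    "'a::real_normed_vector set \<Rightarrow> ('a \<Rightarrow> 'b::real_normed_vector) \<Rightarrow> bool" where
  "smooth_on S f \<longleftrightarrow> (\<forall>k. Ck_on k S f)"

definition partial :: "'n \<Rightarrow> (real ^ 'n::finite \<Rightarrow> 'b::real_normed_vector) \<Rightarrow> real ^ 'n \<Rightarrow> 'b" where
  "partial i f x = frechet_derivative f (at x) (axis i 1)"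

definition vorticity :: "(real ^ 2 \<Rightarrow> real ^ 2) \<Rightarrow> real ^ 2 \<Rightarrow> real" where
  "vorticity v x = partial 1 (\<lambda>y. v y $ 2) x - partial 2 (\<lambda>y. v y $ 1) x"

definition perp :: "real ^ 2 \<Rightarrow> real ^ 2" where
  "perp a = vector [- (a $ 2), a $ 1]"

definition curl :: "(real ^ 3 \<Rightarrow> real ^ 3) \<Rightarrow> real ^ 3 \<Rightarrow> real ^ 3" where
  "curl v x = vector
     [partial 2 (\<lambda>y. v y $ 3) x - partial 3 (\<lambda>y. v y $ 2) x,
      partial 3 (\<lambda>y. v y $ 1) x - partial 1 (\<lambda>y. v y $ 3) x,
      partial 1 (\<lambda>y. v y $ 2) x - partial 2 (\<lambda>y. v y $ 1) x]"

text \<open>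
  The nonlinear term enters as a map \<open>N\<close> sending the velocity field at a fixed time to a vector
  field. All derivatives in the equation exist by smoothness, so they have their usual meaning;
  the time derivative at \<open>t = 0\<close> is one-sided.
\<close>

definition smooth_torus_solution ::
    "((real ^ 'n \<Rightarrow> real ^ 'n) \<Rightarrow> real ^ 'n \<Rightarrow> real ^ 'n) \<Rightarrow> (real ^ 'n \<Rightarrow> real ^ 'n) \<Rightarrow> real \<Rightarrow>
     (real \<Rightarrow> real ^ 'n \<Rightarrow> real ^ 'n::finite) \<Rightarrow> bool" where
  "smooth_torus_solution N u0 T u \<longleftrightarrow>
     smooth_on ({0..<T} \<times> UNIV) (\<lambda>(t, x). u t x) \<and>
     (\<forall>t\<in>{0..<T}. torus_periodic (u t)) \<and>
     (\<forall>t\<in>{0..<T}. \<forall>x.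
        vector_derivative (\<lambda>s. u s x) (at t within {0..<T}) + N (u t) x = 0) \<and>
     u 0 = u0"

definition rotational_term2 :: "(real ^ 2 \<Rightarrow> real ^ 2) \<Rightarrow> real ^ 2 \<Rightarrow> real ^ 2" where
  "rotational_term2 v x = vorticity v x *\<^sub>R perp (v x)"

definition rotational_term3 :: "(real ^ 3 \<Rightarrow> real ^ 3) \<Rightarrow> real ^ 3 \<Rightarrow> real ^ 3" where
  "rotational_term3 v x = cross3 (curl v x) (v x)"

text \<open>
  The solution becomes singular at time \<open>T\<close> by blow-up of its spatial gradient:
  the limes superior, as \<open>t\<close> tends to \<open>T\<close> from below, of the supremum over \<open>x\<close> of the operator
  norm of \<open>\<nabla>u(t, x)\<close> is infinite. In particular, a periodic solution with this property has no
  \<open>C\<^sup>1\<close> extension to the closed time interval \<open>[0, T]\<close>. Since the nonlinear term is orthogonal to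
  \<open>u\<close>, the magnitude of \<open>u\<close> is conserved at every point, so \<open>u\<close> itself stays bounded.
\<close>

definition becomes_singular_at ::
    "real \<Rightarrow> (real \<Rightarrow> real ^ 'n \<Rightarrow> real ^ 'n::finite) \<Rightarrow> bool" where
  "becomes_singular_at T u \<longleftrightarrow>
     (\<forall>M. \<exists>\<^sub>F t in at_left T. \<exists>x. M < onorm (frechet_derivative (u t) (at x)))"

end

theory Submission imports Defs begin

text \<open>
  A field of unit length, \<open>u = (cos \<phi>, sin \<phi>)\<close> with \<open>\<phi>\<close> depending only on \<open>t\<close> and the first
  coordinate \<open>x\<close>, solves the equation as soon as \<open>\<phi>\<^sub>t + cos \<phi> \<phi>\<^sub>x = 0\<close>, so that \<open>cos \<phi>\<close> solves the
  inviscid Burgers equation. With the initial phase \<open>\<phi> = x\<close> the characteristics give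
  \<open>x = \<phi> + t cos \<phi>\<close>. This determines a smooth \<open>\<phi>\<close> for \<open>\<bar>t\<bar> < 1\<close>, with \<open>\<phi>\<^sub>x = 1 / (1 - t sin \<phi>)\<close>, and
  the characteristic that stays at \<open>x = \<pi> / 2\<close> sees \<open>\<phi>\<^sub>x = 1 / (1 - t)\<close> blow up at \<open>t = 1\<close>. All
  derivatives of \<open>u\<close> are polynomials in \<open>t\<close>, \<open>cos \<phi>\<close>, \<open>sin \<phi>\<close> and \<open>1 / (1 - t sin \<phi>)\<close>.
  In three dimensions the third component is zero.
\<close>

section \<open>Smoothness from a class of functions closed under differentiation\<close>

lemma smooth_on_derivative_closed:
  fixes A :: "('a::euclidean_space \<Rightarrow> 'b::real_normed_vector) set"
  assumes dirs: "\<And>p b e. p \<in> S \<Longrightarrow> b \<in> Basis \<Longrightarrow> 0 < e \<Longrightarrow>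
      \<exists>d. 0 < \<bar>d\<bar> \<and> \<bar>d\<bar> < e \<and> p + d *\<^sub>R b \<in> S"
    and deriv: "\<And>f. f \<in> A \<Longrightarrow>
      \<exists>f'. (\<forall>p\<in>S. (f has_derivative f' p) (at p within S)) \<and> (\<forall>v. (\<lambda>p. f' p v) \<in> A)"
    and "f \<in> A"
  shows "smooth_on S f"
proof -
  \<comment> \<open>The induction covers every \<open>g\<close> that agrees on \<open>S\<close> with
    a member of \<open>A\<close>: the directional derivatives formed in \<open>Ck_on\<close> are
    controlled at points of \<open>S\<close> only.\<close>
  have "Ck_on k S g" if "f \<in> A" "\<And>p. p \<in> S \<Longrightarrow> g p = f p" for k f g
    using that
  proof (induction k arbitrary: f g)
    case (0 f g)
    obtain f' where "\<forall>p\<in>S. (f has_derivative f' p) (at p within S)"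
      using deriv[OF 0(1)] by blast
    then have "continuous_on S f"
      using has_derivative_continuous_on by blast
    then show ?case
      using 0(2) by (simp cong: continuous_on_cong)
  next
    case (Suc k f g)
    obtain f' where f': "\<forall>p\<in>S. (f has_derivative f' p) (at p within S)"
      and A: "\<forall>v. (\<lambda>p. f' p v) \<in> A"
      using deriv[OF Suc.prems(1)] by blast
    have g': "(g has_derivative f' p) (at p within S)" if "p \<in> S" for p
      using f' that Suc.prems(2) by (auto intro: has_derivative_transform[of p S g f])
    \<comment> \<open>By \<open>dirs\<close>, \<open>S\<close> accumulates at \<open>p\<close> along
      every basis direction, which makes the derivative within \<open>S\<close> unique.\<close>
    have eq: "frechet_derivative g (at p within S) = f' p" if p: "p \<in> S" for p
    proof (rule frechet_derivative_unique_within)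
      show "(g has_derivative frechet_derivative g (at p within S)) (at p within S)"
        using g'[OF p] frechet_derivative_works differentiableI by blast
    qed (use g'[OF p] dirs[OF p] in auto)
    show ?case
      using g' A by (auto simp: differentiable_on_def differentiable_def eq intro!: Suc.IH)
  qed
  with \<open>f \<in> A\<close> show ?thesis
    by (auto simp: smooth_on_def)
qed

text \<open>A small forward step always stays in the slab: a spatial direction leaves the time
  unchanged, and a time step of at most \<open>(T - t) / 2\<close> ends before \<open>T\<close>.
  This includes the boundary \<open>t = 0\<close>.\<close>

lemma half_open_slab_directions:
  fixes p b :: "real \<times> 'a::euclidean_space"
  assumes "p \<in> {0..<T} \<times> UNIV" "b \<in> Basis" "0 < e"
  shows "\<exists>d. 0 < \<bar>d\<bar> \<and> \<bar>d\<bar> < e \<and> p + d *\<^sub>R b \<in> {0..<T} \<times> UNIV"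
proof -
  obtain t x where p: "p = (t, x)" "0 \<le> t" "t < T"
    using assms(1) by auto
  define d where "d = min e (T - t) / 2"
  have "0 < d" "d < e" "t + d < T"
    using p assms(3) by (auto simp: d_def min_def field_simps)
  moreover have "fst b = 0 \<or> fst b = 1"
    using assms(2) by (auto simp: Basis_prod_def)
  ultimately show ?thesis
    using p by (intro exI[of _ d]) (auto simp: mem_Times_iff)
qed

section \<open>The phase as the inverse of the characteristic map\<close>

text \<open>The foot of the characteristic that reaches a given point at time \<open>t\<close>;
  since the initial phase is the identity, the foot is also the phase carried along.\<close>

definition phase :: "real \<Rightarrow> real \<Rightarrow> real" where
  "phase t = inv (\<lambda>z. z + t * cos z)"

lemma jacobian_pos:
  fixes t z :: real
  assumes "\<bar>t\<bar> < 1"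
  shows "0 < 1 - t * sin z"
proof -
  have "\<bar>t * sin z\<bar> \<le> \<bar>t\<bar> * 1"
    unfolding abs_mult by (intro mult_left_mono) auto
  with assms show ?thesis by linarith
qed

text \<open>The derivative \<open>1 - t * sin z\<close> is positive, which gives injectivity. Points
  move by at most 1, so the intermediate value theorem on \<open>{x - 1..x + 1}\<close> gives
  surjectivity.\<close>

lemma bij_phase_map:
  assumes "\<bar>t\<bar> < 1"
  shows "bij (\<lambda>z::real. z + t * cos z)"
proof (rule bijI)
  have "strict_mono (\<lambda>z. z + t * cos z)"
  proof (rule strict_monoI)
    fix a b :: real assume "a < b"
    then show "a + t * cos a < b + t * cos b"
    proof (rule DERIV_pos_imp_increasing)
      fix z
      have "((\<lambda>z. z + t * cos z) has_real_derivative 1 - t * sin z) (at z)"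
        by (auto intro!: derivative_eq_intros)
      moreover have "0 < 1 - t * sin z"
        by (rule jacobian_pos[OF assms])
      ultimately show "\<exists>y. ((\<lambda>z. z + t * cos z) has_real_derivative y) (at z) \<and> 0 < y"
        by blast
    qed
  qed
  then show "inj (\<lambda>z. z + t * cos z)"
    by (rule strict_mono_imp_inj_on)
  have "\<exists>z. z + t * cos z = x" for x
  proof -
    have tc: "\<bar>t * cos z\<bar> \<le> 1" for z
    proof -
      have "\<bar>t * cos z\<bar> \<le> \<bar>t\<bar> * 1"
        unfolding abs_mult by (intro mult_left_mono) auto
      with assms show ?thesis by linarith
    qed
    have "\<exists>z\<ge>x - 1. z \<le> x + 1 \<and> z + t * cos z = x"
    proof (rule IVT')
      show "x - 1 + t * cos (x - 1) \<le> x" "x \<le> x + 1 + t * cos (x + 1)"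
        using tc[of "x - 1"] tc[of "x + 1"] by linarith+
      show "continuous_on {x - 1..x + 1} (\<lambda>z. z + t * cos z)"
        by (intro continuous_intros)
    qed simp
    then show ?thesis by blast
  qed
  then show "surj (\<lambda>z. z + t * cos z)"
    unfolding surj_def by (simp add: eq_commute)
qed

lemma phase_eq:
  assumes "\<bar>t\<bar> < 1"
  shows "phase t x + t * cos (phase t x) = x"
  using surj_f_inv_f[OF bij_is_surj[OF bij_phase_map[OF assms]], of x] by (simp add: phase_def)

lemma phase_eqI:
  assumes "\<bar>t\<bar> < 1" "z + t * cos z = x"
  shows "phase t x = z"
  using inv_f_eq[OF bij_is_inj[OF bij_phase_map[OF assms(1)]] assms(2)] by (simp add: phase_def)

lemma phase_add_2pi: "\<bar>t\<bar> < 1 \<Longrightarrow> phase t (x + 2 * pi) = phase t x + 2 * pi"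
  using phase_eq[of t x] by (intro phase_eqI) auto

lemma phase_pi_half: "\<bar>t\<bar> < 1 \<Longrightarrow> phase t (pi / 2) = pi / 2"
  by (rule phase_eqI) auto

text \<open>Inverse function theorem for \<open>F\<close>, which straightens characteristics while
  keeping the time. The version used asks for \<open>F\<close> to be continuous with left inverse
  \<open>G\<close> on an open set, and for a right inverse \<open>?G'\<close> of the derivative at
  the point.\<close>

lemma has_derivative_phase_pair:
  assumes "\<bar>t\<bar> < 1"
  shows "((\<lambda>p. phase (fst p) (snd p)) has_derivative
           (\<lambda>v. (snd v - cos (phase t x) * fst v) / (1 - t * sin (phase t x)))) (at (t, x))"
proof -
  define F :: "real \<times> real \<Rightarrow> real \<times> real" where
    "F = (\<lambda>p. (fst p, snd p + fst p * cos (snd p)))"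
  define G where "G = (\<lambda>p. (fst p, phase (fst p) (snd p)))"
  define z where "z = phase t x"
  let ?S = "{-1<..<1::real} \<times> (UNIV :: real set)"
  let ?F' = "\<lambda>v::real \<times> real. (fst v, snd v + (fst v * cos z - t * sin z * snd v))"
  let ?G' = "\<lambda>v::real \<times> real. (fst v, (snd v - cos z * fst v) / (1 - t * sin z))"
  have pos: "0 < 1 - t * sin z"
    using jacobian_pos[OF assms] .
  have "(G has_derivative ?G') (at (F (t, z)))"
  proof (rule has_derivative_inverse_strong[where S = ?S and f' = ?F' and f = F and x = "(t, z)"])
    show "open ?S"
      by (intro open_Times) auto
    show "(t, z) \<in> ?S"
      using assms by auto
    show "continuous_on ?S F"
      unfolding F_def by (intro continuous_intros)
    show "G (F p) = p" if "p \<in> ?S" for p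
      using that by (cases p) (auto simp: F_def G_def intro!: phase_eqI)
    show "(F has_derivative ?F') (at (t, z))"
      unfolding F_def by (auto intro!: derivative_eq_intros simp: algebra_simps)
    show "?F' \<circ> ?G' = id"
    proof (rule ext)
      fix v :: "real \<times> real"
      obtain a b where v: "v = (a, b)" by (cases v)
      have "(b - cos z * a) / (1 - t * sin z)
          + (a * cos z - t * sin z * ((b - cos z * a) / (1 - t * sin z))) = b"
        using pos by (simp add: divide_simps) (simp add: algebra_simps)
      then show "(?F' \<circ> ?G') v = id v"
        by (simp add: v)
    qed
  qed
  moreover have "F (t, z) = (t, x)"
    using phase_eq[OF assms] by (simp add: F_def z_def)
  ultimately have "(G has_derivative ?G') (at (t, x))"
    by simp
  from has_derivative_snd[OF this] show ?thesis
    by (simp add: G_def z_def)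
qed

abbreviation phase_at :: "'n \<Rightarrow> real \<times> (real ^ 'n::finite) \<Rightarrow> real" where
  "phase_at i p \<equiv> phase (fst p) (snd p $ i)"

lemma has_derivative_phase_at:
  assumes "\<bar>fst p\<bar> < 1"
  shows "(phase_at i has_derivative
           (\<lambda>v. (snd v $ i - cos (phase_at i p) * fst v) * inverse (1 - fst p * sin (phase_at i p))))
         (at p)"
proof -
  have "((\<lambda>p. (fst p, snd p $ i)) has_derivative (\<lambda>v. (fst v, snd v $ i))) (at p)"
    by (intro derivative_intros bounded_linear.has_derivative[OF bounded_linear_vec_nth])
  from has_derivative_compose[OF this has_derivative_phase_pair[OF assms, of "snd p $ i"]]
  show ?thesis
    by (simp add: divide_inverse)
qed

section \<open>A function algebra containing all derivatives of the wave components\<close>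

text \<open>The inverse Jacobian is a generator because every derivative of the phase carries it as
  a factor.\<close>

inductive_set phase_algebra :: "'n \<Rightarrow> (real \<times> (real ^ 'n::finite) \<Rightarrow> real) set" for i where
  const: "(\<lambda>p. c) \<in> phase_algebra i"
| time: "fst \<in> phase_algebra i"
| cosine: "(\<lambda>p. cos (phase_at i p)) \<in> phase_algebra i"
| sine: "(\<lambda>p. sin (phase_at i p)) \<in> phase_algebra i"
| jacobian: "(\<lambda>p. inverse (1 - fst p * sin (phase_at i p))) \<in> phase_algebra i"
| add: "f \<in> phase_algebra i \<Longrightarrow> g \<in> phase_algebra i \<Longrightarrow> (\<lambda>p. f p + g p) \<in> phase_algebra i"
| mult: "f \<in> phase_algebra i \<Longrightarrow> g \<in> phase_algebra i \<Longrightarrow> (\<lambda>p. f p * g p) \<in> phase_algebra i"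

lemma phase_algebra_uminus: "f \<in> phase_algebra i \<Longrightarrow> (\<lambda>p. - f p) \<in> phase_algebra i"
  using phase_algebra.mult[OF phase_algebra.const[of "- 1"], of f] by simp

lemma phase_algebra_diff:
  "f \<in> phase_algebra i \<Longrightarrow> g \<in> phase_algebra i \<Longrightarrow> (\<lambda>p. f p - g p) \<in> phase_algebra i"
  using phase_algebra.add[OF _ phase_algebra_uminus, of f i g] by simp

lemmas phase_algebra_intros = phase_algebra.intros phase_algebra_uminus phase_algebra_diff

text \<open>Only the generators need a computation; the sum and product rules do the rest. The
  direction \<open>v\<close> is fixed when membership is claimed, so its components count as
  constants.\<close>

lemma phase_algebra_deriv:
  assumes "f \<in> phase_algebra i"
  shows "\<exists>f'. (\<forall>p. \<bar>fst p\<bar> < 1 \<longrightarrow> (f has_derivative f' p) (at p)) \<and>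
              (\<forall>v. (\<lambda>p. f' p v) \<in> phase_algebra i)"
  using assms
proof induction
  case (const c)
  show ?case
    by (rule exI[of _ "\<lambda>p v. 0"]) (auto intro: phase_algebra_intros)
next
  case time
  show ?case
    by (rule exI[of _ "\<lambda>p v. fst v"]) (auto intro!: phase_algebra_intros derivative_eq_intros)
next
  case cosine
  show ?case
    by (rule exI[of _ "\<lambda>p v. - sin (phase_at i p) *
         ((snd v $ i - cos (phase_at i p) * fst v) * inverse (1 - fst p * sin (phase_at i p)))"])
      (auto intro!: phase_algebra_intros derivative_eq_intros has_derivative_phase_at)
next
  case sine
  show ?case
    by (rule exI[of _ "\<lambda>p v. cos (phase_at i p) *
         ((snd v $ i - cos (phase_at i p) * fst v) * inverse (1 - fst p * sin (phase_at i p)))"])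
      (auto intro!: phase_algebra_intros derivative_eq_intros has_derivative_phase_at)
next
  case jacobian
  let ?J = "\<lambda>p. inverse (1 - fst p * sin (phase_at i p))"
  let ?D = "\<lambda>p v. (snd v $ i - cos (phase_at i p) * fst v) * ?J p"
  have "(?J has_derivative
         (\<lambda>v. ?J p * (fst v * sin (phase_at i p) + fst p * (cos (phase_at i p) * ?D p v)) * ?J p))
        (at p)"
    if "\<bar>fst p\<bar> < 1" for p
  proof -
    have "1 - fst p * sin (phase_at i p) \<noteq> 0"
      using jacobian_pos[OF that, of "phase_at i p"] by linarith
    then show ?thesis
      by (auto intro!: derivative_eq_intros has_derivative_phase_at that simp: algebra_simps)
  qed
  moreover have "(\<lambda>p. ?J p * (fst v * sin (phase_at i p)
      + fst p * (cos (phase_at i p) * ?D p v)) * ?J p) \<in> phase_algebra i" for v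
    by (intro phase_algebra_intros)
  ultimately show ?case
    by (intro exI[of _ "\<lambda>p v. ?J p * (fst v * sin (phase_at i p)
      + fst p * (cos (phase_at i p) * ?D p v)) * ?J p"]) auto
next
  case (add f g)
  then obtain f' g' where
    "\<forall>p. \<bar>fst p\<bar> < 1 \<longrightarrow> (f has_derivative f' p) (at p)" "\<forall>v. (\<lambda>p. f' p v) \<in> phase_algebra i"
    "\<forall>p. \<bar>fst p\<bar> < 1 \<longrightarrow> (g has_derivative g' p) (at p)" "\<forall>v. (\<lambda>p. g' p v) \<in> phase_algebra i"
    by blast
  then show ?case
    by (intro exI[of _ "\<lambda>p v. f' p v + g' p v"])
      (auto intro!: has_derivative_add phase_algebra.add)
next
  case (mult f g)
  then obtain f' g' where
    "\<forall>p. \<bar>fst p\<bar> < 1 \<longrightarrow> (f has_derivative f' p) (at p)" "\<forall>v. (\<lambda>p. f' p v) \<in> phase_algebra i"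
    "\<forall>p. \<bar>fst p\<bar> < 1 \<longrightarrow> (g has_derivative g' p) (at p)" "\<forall>v. (\<lambda>p. g' p v) \<in> phase_algebra i"
    by blast
  then show ?case
    using mult.hyps
    by (intro exI[of _ "\<lambda>p v. f p * g' p v + f' p v * g p"])
      (auto intro!: has_derivative_mult phase_algebra.add phase_algebra.mult)
qed

section \<open>The wave and its derivatives\<close>

text \<open>The index type is arbitrary so that \<open>i = 1\<close>, \<open>j = 2\<close> serves
  both dimensions.\<close>

definition planar_wave :: "'n \<Rightarrow> 'n \<Rightarrow> real \<Rightarrow> real ^ 'n \<Rightarrow> real ^ 'n::finite" where
  "planar_wave i j t x =
     cos (phase t (x $ i)) *\<^sub>R axis i 1 + sin (phase t (x $ i)) *\<^sub>R axis j 1"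

lemma smooth_on_planar_wave:
  "smooth_on ({0..<1} \<times> UNIV) (\<lambda>(t, x). planar_wave i j t x)"
proof (rule smooth_on_derivative_closed)
  \<comment> \<open>The axis vectors are constant, so differentiation acts on the two coefficients
    alone.\<close>
  let ?A = "{\<lambda>p. f p *\<^sub>R axis i 1 + g p *\<^sub>R axis j (1::real) | f g.
    f \<in> phase_algebra i \<and> g \<in> phase_algebra i}"
  have comb: "(\<lambda>p. f p *\<^sub>R axis i 1 + g p *\<^sub>R axis j 1) \<in> ?A"
    if "f \<in> phase_algebra i" "g \<in> phase_algebra i" for f g
    unfolding mem_Collect_eq by (rule exI[of _ f], rule exI[of _ g]) (use that in simp)
  show "(\<lambda>(t, x). planar_wave i j t x) \<in> ?A"
    using comb[OF phase_algebra.cosine phase_algebra.sine]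
    unfolding planar_wave_def split_def .
  fix h assume "h \<in> ?A"
  then obtain f g where h: "h = (\<lambda>p. f p *\<^sub>R axis i 1 + g p *\<^sub>R axis j 1)"
    and fg: "f \<in> phase_algebra i" "g \<in> phase_algebra i"
    by blast
  obtain f' where f': "\<forall>p. \<bar>fst p\<bar> < 1 \<longrightarrow> (f has_derivative f' p) (at p)"
    "\<forall>v. (\<lambda>p. f' p v) \<in> phase_algebra i"
    using phase_algebra_deriv[OF fg(1)] by blast
  obtain g' where g': "\<forall>p. \<bar>fst p\<bar> < 1 \<longrightarrow> (g has_derivative g' p) (at p)"
    "\<forall>v. (\<lambda>p. g' p v) \<in> phase_algebra i"
    using phase_algebra_deriv[OF fg(2)] by blast
  let ?h' = "\<lambda>p v. f' p v *\<^sub>R axis i 1 + g' p v *\<^sub>R axis j (1::real)"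
  have 1: "(h has_derivative ?h' p) (at p within {0..<1} \<times> UNIV)" if "p \<in> {0..<1} \<times> UNIV" for p
  proof -
    have "\<bar>fst p\<bar> < 1" using that by auto
    then have "(f has_derivative f' p) (at p)" "(g has_derivative g' p) (at p)"
      using f'(1) g'(1) by blast+
    from has_derivative_add[OF this[THEN has_derivative_scaleR_left]] show ?thesis
      unfolding h by (rule has_derivative_at_withinI)
  qed
  have 2: "(\<lambda>p. ?h' p v) \<in> ?A" for v
    by (rule comb[OF f'(2)[rule_format] g'(2)[rule_format]])
  show "\<exists>h'. (\<forall>p\<in>{0..<1} \<times> UNIV. (h has_derivative h' p) (at p within {0..<1} \<times> UNIV))
      \<and> (\<forall>v. (\<lambda>p. h' p v) \<in> ?A)"
    using 1 2 by (intro exI[of _ ?h'] conjI ballI allI)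
qed (rule half_open_slab_directions)

text \<open>Chain rule: the derivative of the phase times the derivative of the wave with respect to
  its angle. The time and space derivatives below are restrictions of this one to slices.\<close>

lemma has_derivative_planar_wave_pair:
  fixes i j :: "'n::finite"
  assumes "\<bar>t\<bar> < 1"
  shows "((\<lambda>p. planar_wave i j (fst p) (snd p)) has_derivative
     (\<lambda>v. ((snd v $ i - cos (phase t (x $ i)) * fst v) / (1 - t * sin (phase t (x $ i)))) *\<^sub>R
          (cos (phase t (x $ i)) *\<^sub>R axis j 1 - sin (phase t (x $ i)) *\<^sub>R axis i 1))) (at (t, x))"
proof -
  have "(phase_at i has_derivative
         (\<lambda>v. (snd v $ i - cos (phase t (x $ i)) * fst v) / (1 - t * sin (phase t (x $ i)))))
        (at (t, x))"
    using has_derivative_phase_at[of "(t, x)" i] assms by (simp add: divide_inverse)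
  note cs = has_derivative_cos[OF this] has_derivative_sin[OF this]
  have eq: "(d * - sin z) *\<^sub>R a + (d * cos z) *\<^sub>R b = d *\<^sub>R (cos z *\<^sub>R b - sin z *\<^sub>R a)"
    for d z :: real and a b :: "real ^ 'n"
    by (simp add: scaleR_diff_right)
  show ?thesis
    unfolding planar_wave_def
    using has_derivative_add[OF cs(1)[THEN has_derivative_scaleR_left, of "axis i (1::real)"]
        cs(2)[THEN has_derivative_scaleR_left, of "axis j (1::real)"]]
    unfolding fst_conv snd_conv eq .
qed

lemma has_vector_derivative_planar_wave_time:
  assumes "\<bar>t\<bar> < 1"
  shows "((\<lambda>s. planar_wave i j s x) has_vector_derivative
     (- (cos (phase t (x $ i)) / (1 - t * sin (phase t (x $ i))))) *\<^sub>R
          (cos (phase t (x $ i)) *\<^sub>R axis j 1 - sin (phase t (x $ i)) *\<^sub>R axis i 1)) (at t)"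
proof -
  have "((\<lambda>s. (s, x)) has_derivative (\<lambda>s. (s, 0))) (at t)"
    by (auto intro!: derivative_eq_intros)
  from has_derivative_compose[OF this has_derivative_planar_wave_pair[OF assms]]
  show ?thesis
    by (simp add: has_vector_derivative_def mult.commute)
qed

lemma has_derivative_planar_wave_space:
  assumes "\<bar>t\<bar> < 1"
  shows "(planar_wave i j t has_derivative
     (\<lambda>h. (h $ i / (1 - t * sin (phase t (x $ i)))) *\<^sub>R
          (cos (phase t (x $ i)) *\<^sub>R axis j 1 - sin (phase t (x $ i)) *\<^sub>R axis i 1))) (at x)"
proof -
  have "((\<lambda>y. (t, y)) has_derivative (\<lambda>h. (0, h))) (at x)"
    by (auto intro!: derivative_eq_intros)
  from has_derivative_compose[OF this has_derivative_planar_wave_pair[OF assms]]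
  show ?thesis
    by simp
qed

lemma torus_periodic_planar_wave:
  assumes "\<bar>t\<bar> < 1"
  shows "torus_periodic (planar_wave i j t)"
proof -
  have "planar_wave i j t (x + (2 * pi) *\<^sub>R axis k 1) = planar_wave i j t x" for k x
    by (cases "k = i") (auto simp: planar_wave_def phase_add_2pi[OF assms] axis_def)
  then show ?thesis
    by (simp add: torus_periodic_def)
qed

section \<open>Blow-up of the gradient\<close>

lemma planar_wave_becomes_singular: "becomes_singular_at 1 (planar_wave i j)"
  unfolding becomes_singular_at_def
proof
  fix M :: real
  \<comment> \<open>On this stationary characteristic the phase is \<open>pi / 2\<close>, so the
    Jacobian is \<open>1 - t\<close> and the angular derivative of the wave is
    \<open>- axis i 1\<close>.\<close>
  let ?x = "(pi / 2) *\<^sub>R axis i 1"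
  \<comment> \<open>The threshold is where \<open>1 / (1 - t)\<close> reaches
    \<open>\<bar>M\<bar> + 1\<close>; the maximum with 0 ensures \<open>\<bar>t\<bar> < 1\<close>.
    Testing the gradient on \<open>axis i 1\<close> bounds its norm below by
    \<open>1 / (1 - t)\<close>.\<close>
  have "M < onorm (frechet_derivative (planar_wave i j t) (at ?x))"
    if t: "max 0 (1 - 1 / (\<bar>M\<bar> + 1)) < t" "t < 1" for t
  proof -
    let ?D = "frechet_derivative (planar_wave i j t) (at ?x)"
    have t1: "\<bar>t\<bar> < 1"
      using t by linarith
    have D: "(planar_wave i j t has_derivative (\<lambda>h. (h $ i / (1 - t)) *\<^sub>R (- axis i 1))) (at ?x)"
      using has_derivative_planar_wave_space[OF t1, of i j ?x] by (simp add: phase_pi_half[OF t1])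
    have "?D = (\<lambda>h. (h $ i / (1 - t)) *\<^sub>R (- axis i 1))"
      using frechet_derivative_at[OF D] by simp
    moreover have "bounded_linear ?D"
      using D calculation has_derivative_bounded_linear by metis
    ultimately have "1 / (1 - t) \<le> onorm ?D"
      using onorm[of ?D "axis i 1"] t by simp
    moreover have "\<bar>M\<bar> + 1 < 1 / (1 - t)"
      using t by (simp add: field_simps)
    ultimately show ?thesis
      by linarith
  qed
  moreover have "max 0 (1 - 1 / (\<bar>M\<bar> + 1)) < (1::real)"
    by (simp add: field_simps)
  ultimately have "\<forall>\<^sub>F t in at_left 1. M < onorm (frechet_derivative (planar_wave i j t) (at ?x))"
    by (subst eventually_at_left[of 0]) (auto intro!: exI[of _ "max 0 (1 - 1 / (\<bar>M\<bar> + 1))"])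
  then have "\<exists>\<^sub>F t in at_left 1. M < onorm (frechet_derivative (planar_wave i j t) (at ?x))"
    by (rule eventually_frequently[OF trivial_limit_at_left_real])
  then show "\<exists>\<^sub>F t in at_left 1. \<exists>x. M < onorm (frechet_derivative (planar_wave i j t) (at x))"
    by (rule frequently_elim1) (rule exI)
qed

section \<open>The equation in two and three dimensions\<close>

text \<open>The assumption on \<open>N\<close> gives exactly the negative of the time derivative of
  the wave, so both dimensions reduce to computing the nonlinear term.\<close>

lemma smooth_torus_solution_planar_wave:
  assumes "\<And>t x. 0 \<le> t \<Longrightarrow> t < 1 \<Longrightarrow> N (planar_wave i j t) x =
     (cos (phase t (x $ i)) / (1 - t * sin (phase t (x $ i)))) *\<^sub>R
          (cos (phase t (x $ i)) *\<^sub>R axis j 1 - sin (phase t (x $ i)) *\<^sub>R axis i 1)"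
  shows "smooth_torus_solution N (planar_wave i j 0) 1 (planar_wave i j)"
  unfolding smooth_torus_solution_def
proof (intro conjI ballI allI)
  show "smooth_on ({0..<1} \<times> UNIV) (\<lambda>(t, x). planar_wave i j t x)"
    by (rule smooth_on_planar_wave)
next
  fix t :: real assume "t \<in> {0..<1}"
  then show "torus_periodic (planar_wave i j t)"
    by (intro torus_periodic_planar_wave) auto
next
  fix t :: real and x assume t: "t \<in> {0..<1}"
  \<comment> \<open>No point of the interval is isolated, so the derivative within it is unique,
    also at \<open>t = 0\<close>.\<close>
  then have "at t within {0..<1} \<noteq> bot" and t1: "\<bar>t\<bar> < 1"
    by (auto simp: trivial_limit_within)
  from vector_derivative_within[OF this(1)
      has_vector_derivative_at_within[OF has_vector_derivative_planar_wave_time[OF t1, of i j x]]]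
  show "vector_derivative (\<lambda>s. planar_wave i j s x) (at t within {0..<1})
      + N (planar_wave i j t) x = 0"
    using t by (simp add: assms)
qed simp

lemma partial_component:
  assumes "(v has_derivative D) (at x)"
  shows "partial k (\<lambda>y. v y $ l) x = D (axis k 1) $ l"
proof -
  have "((\<lambda>y. v y $ l) has_derivative (\<lambda>h. D h $ l)) (at x)"
    using bounded_linear.has_derivative[OF bounded_linear_vec_nth assms] .
  from frechet_derivative_at[OF this, symmetric] show ?thesis
    by (simp add: partial_def)
qed

text \<open>Only the first coordinate matters, so the vorticity is the first partial derivative of
  the sine component: the cosine over the Jacobian. The remaining vector is \<open>perp\<close> of
  the wave.\<close>

lemma rotational_term2_planar_wave:
  assumes "\<bar>t\<bar> < 1"
  shows "rotational_term2 (planar_wave 1 2 t) x =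
     (cos (phase t (x $ 1)) / (1 - t * sin (phase t (x $ 1)))) *\<^sub>R
          (cos (phase t (x $ 1)) *\<^sub>R axis 2 1 - sin (phase t (x $ 1)) *\<^sub>R axis 1 1)"
  unfolding rotational_term2_def vorticity_def
    partial_component[OF has_derivative_planar_wave_space[OF assms]]
  by (simp add: vec_eq_iff forall_2 perp_def planar_wave_def axis_def)

text \<open>The third component vanishes and nothing depends on the third coordinate, so the curl is
  the planar vorticity times \<open>axis 3 1\<close>; its cross product with the wave is the planar
  quarter turn.\<close>

lemma rotational_term3_planar_wave:
  assumes "\<bar>t\<bar> < 1"
  shows "rotational_term3 (planar_wave 1 2 t) x =
     (cos (phase t (x $ 1)) / (1 - t * sin (phase t (x $ 1)))) *\<^sub>R
          (cos (phase t (x $ 1)) *\<^sub>R axis 2 1 - sin (phase t (x $ 1)) *\<^sub>R axis 1 1)"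
  unfolding rotational_term3_def curl_def
    partial_component[OF has_derivative_planar_wave_space[OF assms]]
  by (simp add: vec_eq_iff forall_3 cross3_simps planar_wave_def axis_def)

theorem theorem6p2:
  "(\<exists>(u0 :: real ^ 2 \<Rightarrow> real ^ 2) T u. 0 < T \<and>
      smooth_torus_solution rotational_term2 u0 T u \<and> becomes_singular_at T u) \<and>
   (\<exists>(u0 :: real ^ 3 \<Rightarrow> real ^ 3) T u. 0 < T \<and>
      smooth_torus_solution rotational_term3 u0 T u \<and> becomes_singular_at T u)"
proof (intro conjI exI)
  show "smooth_torus_solution rotational_term2 (planar_wave 1 2 0) 1 (planar_wave 1 2)"
    by (intro smooth_torus_solution_planar_wave rotational_term2_planar_wave) auto
  show "smooth_torus_solution rotational_term3 (planar_wave 1 2 0) 1 (planar_wave 1 2)"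
    by (intro smooth_torus_solution_planar_wave rotational_term3_planar_wave) auto
qed (auto intro!: planar_wave_becomes_singular)

end
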